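(* Let $m$ be Lebesgue measure on $[0,1]$ and let $L_0$ be the space of (classes of) Lebesgue measurable functions $[0,1]\to\mathbb{R}$, where functions equal a.e. are identified, with the topology of convergence in measure; endow $L_0^{\mathbb{N}}$ with the product topology. The family of all sequences $(f_n)_n\in L_0^{\mathbb{N}}$ such that $f_n\to 0$ in measure but $(f_n)_n$ does not converge (to zero) a.e. in $[0,1]$ is spaceable in $L_0^{\mathbb{N}}$.
   Context: The topology on $L_0$ is the one given by the metric $\rho(f,g)=\int_{[0,1]}\frac{|f(x)-g(x)|}{1+|f(x)-g(x)|}\,dx$, for which $\rho(f_n,f)\to0$ if and only if $f_n\to f$ in measure. The topology on $L_0^{\mathbb{N}}$ is the one given by the product metric $D((f_n)_n,(g_n)_n)=\sum_{n=1}^\infty \frac{1}{2^n}\cdot\frac{\rho(f_n,g_n)}{1+\rho(f_n,g_n)}$; with it $L_0^{\mathbb{N}}$ is a separable, complete metrizable topological vector space (with coordinatewise operations). A sequence $(f_n)_n\subset L_0$ converges to $f$ in measure if $\lim_{n\to\infty} m(\{x\in[0,1]: |f_n(x)-f(x)|>\varepsilon\})=0$ for every $\varepsilon>0$. It converges to $f$ a.e. in $[0,1]$ if there is a measurable set $E$ with $m(E)=0$ and $f_n\to f$ pointwise on $[0,1]\setminus E$. A subset $A$ of a topological vector space $X$ is spaceable in $X$ if there exists a closed infinite dimensional vector subspace $M$ of $X$ such that $M\setminus\{0\}\subset A$. *)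

theory Defs
  imports "HOL-Analysis.Analysis" "HOL-Library.Function_Algebras"
begin

section \<open>Topological vector spaces and spaceability\<close>

class topological_real_vector = real_vector + topological_ab_group_add +
  assumes tendsto_scaleR_nhds:
    "((\<lambda>x. fst x *\<^sub>R snd x) \<longlongrightarrow> c *\<^sub>R a) (nhds c \<times>\<^sub>F nhds a)"

definition infinite_dimensional :: "'a::real_vector set \<Rightarrow> bool" where
  "infinite_dimensional M \<longleftrightarrow> \<not> (\<exists>B. finite B \<and> span B = M)"

definition spaceable :: "'a::topological_real_vector set \<Rightarrow> bool" where
  "spaceable A \<longleftrightarrow>
     (\<exists>M. subspace M \<and> closed M \<and> infinite_dimensional M \<and> M - {0} \<subseteq> A)"


section \<open>The space of classes of measurable functions on the unit interval\<close>

abbreviation lebesgue01 :: "real measure" where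
  "lebesgue01 \<equiv> lebesgue_on {0..1}"

text \<open>
  A function on \<^term>\<open>{0..1::real}\<close> is represented by a total function; \<^term>\<open>lebesgue01\<close>
  lives on the interval, so values outside are neither constrained nor distinguished.
\<close>

definition ae_eq :: "(real \<Rightarrow> real) \<Rightarrow> (real \<Rightarrow> real) \<Rightarrow> bool" where
  "ae_eq f g \<longleftrightarrow>
     f \<in> borel_measurable lebesgue01 \<and> g \<in> borel_measurable lebesgue01 \<and> (AE x in lebesgue01. f x = g x)"

quotient_type L0 = "real \<Rightarrow> real" / partial: ae_eq
proof (rule part_equivpI)
  show "\<exists>f. ae_eq f f"
    by (rule exI[of _ "\<lambda>_. 0"]) (simp add: ae_eq_def)
  show "symp ae_eq"
    by (auto simp: ae_eq_def symp_def eq_commute)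
  show "transp ae_eq"
    unfolding ae_eq_def transp_def by (auto elim: AE_mp)
qed

lemma finite_measure_lebesgue01: "finite_measure lebesgue01"
  by (rule finite_measure_lebesgue_on) simp

definition rho :: "(real \<Rightarrow> real) \<Rightarrow> (real \<Rightarrow> real) \<Rightarrow> real" where
  "rho f g = (LINT x|lebesgue01. \<bar>f x - g x\<bar> / (1 + \<bar>f x - g x\<bar>))"

lemma rho_integrand_less_1: "\<bar>t\<bar> / (1 + \<bar>t\<bar>) < (1::real)"
  by (simp add: divide_less_eq)

lemma rho_integrand_mono:
  assumes "0 \<le> s" "s \<le> (t::real)"
  shows "s / (1 + s) \<le> t / (1 + t)"
  using assms by (simp add: field_simps)

lemma rho_integrand_add:
  "\<bar>s + t\<bar> / (1 + \<bar>s + t\<bar>) \<le> \<bar>s\<bar> / (1 + \<bar>s\<bar>) + \<bar>t\<bar> / (1 + \<bar>t\<bar>)" for s t :: real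
proof -
  have "\<bar>s + t\<bar> / (1 + \<bar>s + t\<bar>) \<le> (\<bar>s\<bar> + \<bar>t\<bar>) / (1 + (\<bar>s\<bar> + \<bar>t\<bar>))"
    by (rule rho_integrand_mono) auto
  also have "\<dots> = \<bar>s\<bar> / (1 + (\<bar>s\<bar> + \<bar>t\<bar>)) + \<bar>t\<bar> / (1 + (\<bar>s\<bar> + \<bar>t\<bar>))"
    by (simp add: add_divide_distrib)
  also have "\<dots> \<le> \<bar>s\<bar> / (1 + \<bar>s\<bar>) + \<bar>t\<bar> / (1 + \<bar>t\<bar>)"
    by (intro add_mono divide_left_mono) (auto intro!: mult_pos_pos add_pos_nonneg)
  finally show ?thesis .
qed

lemma rho_integrand_scale:
  "\<bar>c * t\<bar> / (1 + \<bar>c * t\<bar>) \<le> (1 + \<bar>c\<bar>) * (\<bar>t\<bar> / (1 + \<bar>t\<bar>))" for c t :: real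
proof -
  have "\<bar>c * t\<bar> / (1 + \<bar>c * t\<bar>) \<le> ((1 + \<bar>c\<bar>) * \<bar>t\<bar>) / (1 + (1 + \<bar>c\<bar>) * \<bar>t\<bar>)"
    by (rule rho_integrand_mono) (auto simp: abs_mult distrib_right)
  also have "\<dots> \<le> ((1 + \<bar>c\<bar>) * \<bar>t\<bar>) / (1 + \<bar>t\<bar>)"
    by (rule divide_left_mono) (auto simp: distrib_right intro!: mult_pos_pos add_pos_nonneg)
  finally show ?thesis by simp
qed

lemma rho_integrable:
  fixes f g :: "real \<Rightarrow> real"
  assumes [measurable]: "f \<in> borel_measurable lebesgue01" "g \<in> borel_measurable lebesgue01"
  shows "integrable lebesgue01 (\<lambda>x. \<bar>f x - g x\<bar> / (1 + \<bar>f x - g x\<bar>))"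
proof (rule finite_measure.integrable_const_bound[OF finite_measure_lebesgue01, where B = 1])
  show "AE x in lebesgue01. norm (\<bar>f x - g x\<bar> / (1 + \<bar>f x - g x\<bar>)) \<le> 1"
    by (intro AE_I2) (simp add: rho_integrand_less_1 less_imp_le)
qed measurable

lemma rho_cong:
  assumes "ae_eq f f'" "ae_eq g g'"
  shows "rho f g = rho f' g'"
  unfolding rho_def
proof (rule integral_cong_AE)
  have [measurable]: "f \<in> borel_measurable lebesgue01" "f' \<in> borel_measurable lebesgue01"
    "g \<in> borel_measurable lebesgue01" "g' \<in> borel_measurable lebesgue01"
    using assms by (auto simp: ae_eq_def)
  show "(\<lambda>x. \<bar>f x - g x\<bar> / (1 + \<bar>f x - g x\<bar>)) \<in> borel_measurable lebesgue01"
       "(\<lambda>x. \<bar>f' x - g' x\<bar> / (1 + \<bar>f' x - g' x\<bar>)) \<in> borel_measurable lebesgue01"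
    by measurable
  show "AE x in lebesgue01. \<bar>f x - g x\<bar> / (1 + \<bar>f x - g x\<bar>) = \<bar>f' x - g' x\<bar> / (1 + \<bar>f' x - g' x\<bar>)"
    using assms unfolding ae_eq_def by (auto elim!: AE_mp)
qed

lemma rho_eq_0_iff:
  assumes [measurable]: "f \<in> borel_measurable lebesgue01" "g \<in> borel_measurable lebesgue01"
  shows "rho f g = 0 \<longleftrightarrow> (AE x in lebesgue01. f x = g x)"
proof -
  have "rho f g = 0 \<longleftrightarrow> (AE x in lebesgue01. \<bar>f x - g x\<bar> / (1 + \<bar>f x - g x\<bar>) = 0)"
    unfolding rho_def by (rule integral_nonneg_eq_0_iff_AE[OF rho_integrable]) auto
  also have "\<dots> \<longleftrightarrow> (AE x in lebesgue01. f x = g x)"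
  proof -
    have "\<bar>f x - g x\<bar> / (1 + \<bar>f x - g x\<bar>) = 0 \<longleftrightarrow> f x = g x" for x
      by (smt (verit) divide_eq_0_iff)
    then show ?thesis by simp
  qed
  finally show ?thesis .
qed

lemma rho_triangle2:
  assumes [measurable]: "f \<in> borel_measurable lebesgue01" "g \<in> borel_measurable lebesgue01" "h \<in> borel_measurable lebesgue01"
  shows "rho f g \<le> rho f h + rho g h"
proof -
  have "rho f g \<le> (LINT x|lebesgue01. \<bar>f x - h x\<bar> / (1 + \<bar>f x - h x\<bar>) + \<bar>g x - h x\<bar> / (1 + \<bar>g x - h x\<bar>))"
    unfolding rho_def
  proof (intro integral_mono Bochner_Integration.integrable_add rho_integrable assms)
    show "\<bar>f x - g x\<bar> / (1 + \<bar>f x - g x\<bar>)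
        \<le> \<bar>f x - h x\<bar> / (1 + \<bar>f x - h x\<bar>) + \<bar>g x - h x\<bar> / (1 + \<bar>g x - h x\<bar>)" for x
      using rho_integrand_add[of "f x - h x" "h x - g x"] by (simp add: abs_minus_commute)
  qed
  also have "\<dots> = rho f h + rho g h"
    unfolding rho_def by (intro Bochner_Integration.integral_add rho_integrable assms)
  finally show ?thesis .
qed

instantiation L0 :: real_vector
begin

lift_definition zero_L0 :: L0 is "\<lambda>_. 0"
  by (simp add: ae_eq_def)

lift_definition plus_L0 :: "L0 \<Rightarrow> L0 \<Rightarrow> L0" is "\<lambda>f g x. f x + g x"
  by (auto simp: ae_eq_def elim!: AE_mp)

lift_definition minus_L0 :: "L0 \<Rightarrow> L0 \<Rightarrow> L0" is "\<lambda>f g x. f x - g x"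
  by (auto simp: ae_eq_def elim!: AE_mp)

lift_definition uminus_L0 :: "L0 \<Rightarrow> L0" is "\<lambda>f x. - f x"
  by (auto simp: ae_eq_def elim!: AE_mp)

lift_definition scaleR_L0 :: "real \<Rightarrow> L0 \<Rightarrow> L0" is "\<lambda>c f x. c * f x"
  by (auto simp: ae_eq_def elim!: AE_mp)

instance
  by standard (transfer; auto simp: ae_eq_def algebra_simps)+

end

instantiation L0 :: metric_space
begin

lift_definition dist_L0 :: "L0 \<Rightarrow> L0 \<Rightarrow> real" is rho
  by (rule rho_cong)

definition uniformity_L0 :: "(L0 \<times> L0) filter" where
  "uniformity_L0 = (INF e\<in>{0<..}. principal {(f, g). dist f g < e})"

definition open_L0 :: "L0 set \<Rightarrow> bool" where
  "open_L0 U \<longleftrightarrow> (\<forall>f\<in>U. \<forall>\<^sub>F (f', g) in uniformity. f' = f \<longrightarrow> g \<in> U)"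

instance
proof
  show "(dist f g = 0) = (f = g)" for f g :: L0
    by transfer (auto simp: ae_eq_def rho_eq_0_iff)
  show "dist f g \<le> dist f h + dist g h" for f g h :: L0
    by transfer (auto simp: ae_eq_def intro: rho_triangle2)
qed (auto simp: uniformity_L0_def open_L0_def)

end

lemma dist_L0_add_cancel: "dist (f + h) (g + h) = dist f g" for f g h :: L0
  by transfer (simp add: rho_def)

lemma dist_L0_uminus: "dist (- f) (- g) = dist f g" for f g :: L0
  by transfer (simp add: rho_def abs_minus_commute)

lemma dist_L0_scaleR: "dist (c *\<^sub>R f) (c *\<^sub>R g) \<le> (1 + \<bar>c\<bar>) * dist f g" for f g :: L0
proof (transfer fixing: c)
  fix f g assume "ae_eq f f" "ae_eq g g"
  then have [measurable]: "f \<in> borel_measurable lebesgue01" "g \<in> borel_measurable lebesgue01"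
    by (auto simp: ae_eq_def)
  have "rho (\<lambda>x. c * f x) (\<lambda>x. c * g x)
      \<le> (LINT x|lebesgue01. (1 + \<bar>c\<bar>) * (\<bar>f x - g x\<bar> / (1 + \<bar>f x - g x\<bar>)))"
    unfolding rho_def
  proof (rule integral_mono)
    show "\<bar>c * f x - c * g x\<bar> / (1 + \<bar>c * f x - c * g x\<bar>)
        \<le> (1 + \<bar>c\<bar>) * (\<bar>f x - g x\<bar> / (1 + \<bar>f x - g x\<bar>))" for x
      using rho_integrand_scale[of c "f x - g x"] by (simp add: right_diff_distrib)
    show "integrable lebesgue01 (\<lambda>x. \<bar>c * f x - c * g x\<bar> / (1 + \<bar>c * f x - c * g x\<bar>))"
      by (rule rho_integrable) measurable
    show "integrable lebesgue01 (\<lambda>x. (1 + \<bar>c\<bar>) * (\<bar>f x - g x\<bar> / (1 + \<bar>f x - g x\<bar>)))"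
      by (intro integrable_mult_right rho_integrable) measurable
  qed
  also have "\<dots> = (1 + \<bar>c\<bar>) * rho f g"
    unfolding rho_def by (rule integral_mult_right_zero)
  finally show "rho (\<lambda>x. c * f x) (\<lambda>x. c * g x) \<le> (1 + \<bar>c\<bar>) * rho f g" .
qed

lemma L0_scaleR_seq:
  fixes f :: L0
  assumes "X \<longlonglongrightarrow> c"
  shows "(\<lambda>n. dist (X n *\<^sub>R f) (c *\<^sub>R f)) \<longlonglongrightarrow> 0"
  using assms
proof (transfer fixing: X c)
  fix f assume X: "X \<longlonglongrightarrow> c" and "ae_eq f f"
  then have [measurable]: "f \<in> borel_measurable lebesgue01"
    by (auto simp: ae_eq_def)
  have "(\<lambda>n. LINT x|lebesgue01. \<bar>X n * f x - c * f x\<bar> / (1 + \<bar>X n * f x - c * f x\<bar>))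
      \<longlonglongrightarrow> (LINT x|lebesgue01. 0)"
  proof (rule integral_dominated_convergence[where w = "\<lambda>_. 1"])
    show "integrable lebesgue01 (\<lambda>_. 1 :: real)"
      using finite_measure_lebesgue01 by (simp add: finite_measure.integrable_const)
    show "AE x in lebesgue01. (\<lambda>n. \<bar>X n * f x - c * f x\<bar> / (1 + \<bar>X n * f x - c * f x\<bar>)) \<longlonglongrightarrow> 0"
    proof (rule AE_I2)
      fix x
      have "(\<lambda>n. \<bar>X n * f x - c * f x\<bar> / (1 + \<bar>X n * f x - c * f x\<bar>))
          \<longlonglongrightarrow> \<bar>c * f x - c * f x\<bar> / (1 + \<bar>c * f x - c * f x\<bar>)"
        by (intro tendsto_intros X) auto
      then show "(\<lambda>n. \<bar>X n * f x - c * f x\<bar> / (1 + \<bar>X n * f x - c * f x\<bar>)) \<longlonglongrightarrow> 0"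
        by simp
    qed
    show "AE x in lebesgue01. norm (\<bar>X n * f x - c * f x\<bar> / (1 + \<bar>X n * f x - c * f x\<bar>)) \<le> 1" for n
      by (intro AE_I2) (simp add: rho_integrand_less_1 less_imp_le)
  qed measurable
  then show "(\<lambda>n. rho (\<lambda>x. X n * f x) (\<lambda>x. c * f x)) \<longlonglongrightarrow> 0"
    by (simp add: rho_def)
qed

instance L0 :: topological_real_vector
proof
  fix a b :: L0 and c :: real
  show "((\<lambda>x. fst x + snd x) \<longlongrightarrow> a + b) (nhds a \<times>\<^sub>F nhds b)"
  proof (rule tendstoI)
    fix e :: real assume "e > 0"
    have ev: "\<forall>\<^sub>F x in nhds a \<times>\<^sub>F nhds b. dist (fst x) a < e/2 \<and> dist (snd x) b < e/2"
      using \<open>e > 0\<close>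
      by (intro eventually_prodI[of _ "nhds a" _ "nhds b"] eventually_nhds_metric[THEN iffD2])
         (auto intro!: exI[of _ "e/2"])
    show "\<forall>\<^sub>F x in nhds a \<times>\<^sub>F nhds b. dist (fst x + snd x) (a + b) < e"
      using ev
    proof eventually_elim
      case (elim x)
      have "dist (fst x + snd x) (a + b)
          \<le> dist (fst x + snd x) (a + snd x) + dist (snd x + a) (b + a)"
        using dist_triangle[of "fst x + snd x" "a + b" "a + snd x"] by (simp add: add.commute)
      then show ?case
        using elim by (simp add: dist_L0_add_cancel)
    qed
  qed
  show "(uminus \<longlongrightarrow> - a) (nhds a)"
    by (rule tendstoI) (auto simp: dist_L0_uminus eventually_nhds_metric)
  have "((\<lambda>d. dist (d *\<^sub>R a) (c *\<^sub>R a)) \<longlongrightarrow> 0) (nhds c)"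
  proof -
    have "isCont (\<lambda>d. dist (d *\<^sub>R a) (c *\<^sub>R a)) c"
      unfolding continuous_at_sequentially comp_def
      using L0_scaleR_seq by simp
    then show ?thesis
      using tendsto_at_iff_tendsto_nhds[of "\<lambda>d. dist (d *\<^sub>R a) (c *\<^sub>R a)" c]
      by (simp add: isCont_def)
  qed
  then have 1: "((\<lambda>x. dist (fst x *\<^sub>R a) (c *\<^sub>R a)) \<longlongrightarrow> 0) (nhds c \<times>\<^sub>F nhds a)"
    by (rule filterlim_compose[OF _ filterlim_fst])
  have f: "((\<lambda>x. fst x) \<longlongrightarrow> c) (nhds c \<times>\<^sub>F nhds a)"
    by (rule filterlim_fst)
  have s: "((\<lambda>x. snd x) \<longlongrightarrow> a) (nhds c \<times>\<^sub>F nhds a)"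
    by (rule filterlim_snd)
  have "((\<lambda>x. (1 + \<bar>fst x\<bar>) * dist (snd x) a + dist (fst x *\<^sub>R a) (c *\<^sub>R a))
      \<longlongrightarrow> (1 + \<bar>c\<bar>) * dist a a + 0) (nhds c \<times>\<^sub>F nhds a)"
    by (intro tendsto_intros f s 1)
  then have 2: "((\<lambda>x. (1 + \<bar>fst x\<bar>) * dist (snd x) a + dist (fst x *\<^sub>R a) (c *\<^sub>R a))
      \<longlongrightarrow> 0) (nhds c \<times>\<^sub>F nhds a)"
    by simp
  show "((\<lambda>x. fst x *\<^sub>R snd x) \<longlongrightarrow> c *\<^sub>R a) (nhds c \<times>\<^sub>F nhds a)"
  proof (rule tendsto_dist_iff[THEN iffD2], rule tendsto_sandwich[OF _ _ tendsto_const 2])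
    show "\<forall>\<^sub>F x in nhds c \<times>\<^sub>F nhds a. dist (fst x *\<^sub>R snd x) (c *\<^sub>R a)
        \<le> (1 + \<bar>fst x\<bar>) * dist (snd x) a + dist (fst x *\<^sub>R a) (c *\<^sub>R a)"
    proof (rule always_eventually, rule allI)
      fix x
      show "dist (fst x *\<^sub>R snd x) (c *\<^sub>R a)
        \<le> (1 + \<bar>fst x\<bar>) * dist (snd x) a + dist (fst x *\<^sub>R a) (c *\<^sub>R a)"
        using dist_triangle[of "fst x *\<^sub>R snd x" "c *\<^sub>R a" "fst x *\<^sub>R a"]
          dist_L0_scaleR[of "fst x" "snd x" a] by simp
    qed
  qed simp
qed


section \<open>Sequences: coordinatewise operations and product topology\<close>

text \<open>
  Addition on functions comes from \<^theory>\<open>HOL-Library.Function_Algebras\<close>; the topology on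
  functions is the product topology of \<^theory>\<open>HOL-Analysis.Function_Topology\<close>.
\<close>

instantiation "fun" :: (type, real_vector) real_vector
begin

definition scaleR_fun :: "real \<Rightarrow> ('a \<Rightarrow> 'b) \<Rightarrow> 'a \<Rightarrow> 'b" where
  "scaleR_fun c f = (\<lambda>x. c *\<^sub>R f x)"

instance
  by standard (simp_all add: scaleR_fun_def fun_eq_iff scaleR_add_right scaleR_add_left)

end

lemma scaleR_fun_apply [simp]: "(c *\<^sub>R f) x = c *\<^sub>R f x"
  by (simp add: scaleR_fun_def)

lemma tendsto_fun_coordinatewise:
  fixes f :: "'c \<Rightarrow> 'a \<Rightarrow> 'b::topological_space"
  assumes "\<And>i. ((\<lambda>x. f x i) \<longlongrightarrow> l i) F"
  shows "(f \<longlongrightarrow> l) F"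
  using assms limitin_componentwise[of "\<lambda>_. euclidean" UNIV f l F]
  by (simp add: euclidean_product_topology)

lemma filterlim_apply_nhds:
  "((\<lambda>f. f i) \<longlongrightarrow> a i) (nhds (a :: 'a \<Rightarrow> 'b::topological_space))"
proof -
  have "continuous_on UNIV (\<lambda>f :: 'a \<Rightarrow> 'b. f i)"
    by (rule continuous_on_product_coordinates)
  then have "((\<lambda>f. f i) \<longlongrightarrow> a i) (at a)"
    unfolding continuous_on_def by blast
  then show ?thesis
    using tendsto_at_iff_tendsto_nhds[of "\<lambda>f :: 'a \<Rightarrow> 'b. f i" a] by simp
qed

instance "fun" :: (type, topological_real_vector) topological_real_vector
proof
  fix a b :: "'a \<Rightarrow> 'b" and c :: real
  have f: "((\<lambda>x. fst x i) \<longlongrightarrow> a i) (nhds a \<times>\<^sub>F nhds b)" for i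
    by (rule filterlim_compose[OF filterlim_apply_nhds filterlim_fst])
  have s: "((\<lambda>x. snd x i) \<longlongrightarrow> b i) (F \<times>\<^sub>F nhds b)" for i b and F :: "'c filter"
    by (rule filterlim_compose[OF filterlim_apply_nhds filterlim_snd])
  show "((\<lambda>x. fst x + snd x) \<longlongrightarrow> a + b) (nhds a \<times>\<^sub>F nhds b)"
    by (rule tendsto_fun_coordinatewise) (auto intro!: tendsto_add f s)
  show "(uminus \<longlongrightarrow> - a) (nhds a)"
    by (rule tendsto_fun_coordinatewise) (auto intro!: tendsto_minus filterlim_apply_nhds)
  show "((\<lambda>x. fst x *\<^sub>R snd x) \<longlongrightarrow> c *\<^sub>R a) (nhds c \<times>\<^sub>F nhds a)"
  proof (rule tendsto_fun_coordinatewise)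
    fix i
    have "((\<lambda>x. (fst x, snd x i)) \<longlongrightarrow> (c, a i)) (nhds c \<times>\<^sub>F nhds a)"
      by (intro tendsto_Pair filterlim_fst s)
    from filterlim_compose[OF tendsto_scaleR_nhds[of c "a i"] this[unfolded nhds_prod]]
    show "((\<lambda>x. (fst x *\<^sub>R snd x) i) \<longlongrightarrow> (c *\<^sub>R a) i) (nhds c \<times>\<^sub>F nhds a)"
      by simp
  qed
qed


section \<open>Modes of convergence\<close>

lift_definition converges_in_measure :: "(nat \<Rightarrow> L0) \<Rightarrow> L0 \<Rightarrow> bool" is
  "\<lambda>f g. \<forall>\<epsilon>>0. (\<lambda>n. measure lebesgue01 {x \<in> {0..1}. \<bar>f n x - g x\<bar> > \<epsilon>}) \<longlonglongrightarrow> 0"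
proof -
  fix f f' :: "nat \<Rightarrow> real \<Rightarrow> real" and g g'
  assume f: "\<And>n. ae_eq (f n) (f' n)" and g: "ae_eq g g'"
  have "measure lebesgue01 {x \<in> {0..1}. \<bar>f n x - g x\<bar> > \<epsilon>} = measure lebesgue01 {x \<in> {0..1}. \<bar>f' n x - g' x\<bar> > \<epsilon>}"
    for n \<epsilon>
  proof (rule measure_eq_AE)
    have [measurable]: "f n \<in> borel_measurable lebesgue01" "f' n \<in> borel_measurable lebesgue01"
      "g \<in> borel_measurable lebesgue01" "g' \<in> borel_measurable lebesgue01"
      using f[of n] g by (auto simp: ae_eq_def)
    have "{x \<in> space lebesgue01. \<bar>f n x - g x\<bar> > \<epsilon>} \<in> sets lebesgue01" "{x \<in> space lebesgue01. \<bar>f' n x - g' x\<bar> > \<epsilon>} \<in> sets lebesgue01"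
      by measurable
    then show "{x \<in> {0..1}. \<bar>f n x - g x\<bar> > \<epsilon>} \<in> sets lebesgue01"
       "{x \<in> {0..1}. \<bar>f' n x - g' x\<bar> > \<epsilon>} \<in> sets lebesgue01"
      by simp_all
    show "AE x in lebesgue01. x \<in> {x \<in> {0..1}. \<bar>f n x - g x\<bar> > \<epsilon>} \<longleftrightarrow> x \<in> {x \<in> {0..1}. \<bar>f' n x - g' x\<bar> > \<epsilon>}"
      using f[of n] g by (auto simp: ae_eq_def elim!: AE_mp)
  qed
  then show "(\<forall>\<epsilon>>0. (\<lambda>n. measure lebesgue01 {x \<in> {0..1}. \<bar>f n x - g x\<bar> > \<epsilon>}) \<longlonglongrightarrow> 0) =
      (\<forall>\<epsilon>>0. (\<lambda>n. measure lebesgue01 {x \<in> {0..1}. \<bar>f' n x - g' x\<bar> > \<epsilon>}) \<longlonglongrightarrow> 0)"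
    by simp
qed

lift_definition converges_ae :: "(nat \<Rightarrow> L0) \<Rightarrow> L0 \<Rightarrow> bool" is
  "\<lambda>f g. AE x in lebesgue01. (\<lambda>n. f n x) \<longlonglongrightarrow> g x"
proof -
  fix f f' :: "nat \<Rightarrow> real \<Rightarrow> real" and g g'
  assume f: "\<And>n. ae_eq (f n) (f' n)" and g: "ae_eq g g'"
  from f have "AE x in lebesgue01. f n x = f' n x" for n
    by (simp add: ae_eq_def)
  then have "AE x in lebesgue01. \<forall>n. f n x = f' n x"
    by (simp add: AE_all_countable)
  moreover have "AE x in lebesgue01. g x = g' x"
    using g by (simp add: ae_eq_def)
  ultimately have "AE x in lebesgue01. ((\<lambda>n. f n x) \<longlonglongrightarrow> g x) = ((\<lambda>n. f' n x) \<longlonglongrightarrow> g' x)"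
    by eventually_elim simp
  then show "(AE x in lebesgue01. (\<lambda>n. f n x) \<longlonglongrightarrow> g x) = (AE x in lebesgue01. (\<lambda>n. f' n x) \<longlonglongrightarrow> g' x)"
    by (rule eventually_cong)
qed

end

theory Submission
  imports Defs "HOL-Library.Discrete_Functions"
begin

text \<open>
  Let \<open>A\<^sub>0, A\<^sub>1, \<dots>\<close> be the typewriter sequence of dyadic subintervals of \<open>[0,1]\<close>, starting with
  \<open>A\<^sub>0 = [0,1]\<close>: their lengths tend to \<open>0\<close>, yet every point of \<open>[0,1]\<close> lies in infinitely many of them.
  The classical example of a sequence tending to \<open>0\<close> in measure but not almost everywhere is that of
  the indicators \<open>\<chi>\<^sub>n\<close> of the \<open>A\<^sub>n\<close>. The point is that these may be multiplied by an arbitrary measurable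
  function \<open>h\<close>: the sequence \<open>(\<chi>\<^sub>n h)\<^sub>n\<close> tends to \<open>0\<close> in measure because its \<open>n\<close>-th term lives on
  \<open>A\<^sub>n\<close> (\<open>cutoff_tw_converges_in_measure\<close>), and at each point \<open>x\<close> it takes the value \<open>h x\<close>
  infinitely often, so it can tend to \<open>0\<close> almost everywhere only if \<open>h = 0\<close> almost everywhere
  (\<open>cutoff_tw_converges_ae_imp_0\<close>).

  Hence the space \<open>M\<close> of all sequences \<open>(\<chi>\<^sub>n h)\<^sub>n\<close> is a witness. Since \<open>A\<^sub>0 = [0,1]\<close>, the function \<open>h\<close>
  is the initial term of its sequence, so \<open>M\<close> consists of the sequences \<open>f\<close> with
  \<open>f n = \<chi>\<^sub>n (f 0)\<close> for all \<open>n\<close>. This makes \<open>M\<close> closed, as multiplication by an indicator does not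
  increase distances, and isomorphic to \<open>L\<^sub>0\<close>, which has infinite dimension because the indicators of
  non-overlapping intervals are linearly independent.
\<close>

section \<open>Infinite-dimensional subspaces\<close>

text \<open>
  Applying \<open>T i\<close> to a linear relation between the \<open>v j\<close> isolates the coefficient of \<open>v i\<close>, so the
  \<open>v j\<close> are distinct and independent. Allowing the \<open>T i\<close> to be vector-valued, in place of the usual
  functionals, lets multiplication by an indicator take their role.
\<close>

lemma infinite_dimensional_if_biorthogonal:
  fixes v :: "nat \<Rightarrow> 'a::real_vector" and T :: "nat \<Rightarrow> 'a \<Rightarrow> 'b::real_vector"
  assumes v: "\<And>i. v i \<in> M" and T: "\<And>i. linear (T i)"
    and diag: "\<And>i. T i (v i) \<noteq> 0" and off: "\<And>i j. i \<noteq> j \<Longrightarrow> T i (v j) = 0"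
  shows "infinite_dimensional M"
  unfolding infinite_dimensional_def
proof
  assume "\<exists>B. finite B \<and> span B = M"
  then obtain B where B: "finite B" "span B = M" by blast
  have "independent (range v)"
    unfolding dependent_explicit
  proof
    assume "\<exists>t u. finite t \<and> t \<subseteq> range v \<and> (\<Sum>w\<in>t. u w *\<^sub>R w) = 0 \<and> (\<exists>w\<in>t. u w \<noteq> 0)"
    then obtain t u i where t: "finite t" "t \<subseteq> range v" and sum0: "(\<Sum>w\<in>t. u w *\<^sub>R w) = 0"
      and i: "v i \<in> t" "u (v i) \<noteq> 0"
      by blast
    have "0 = T i (\<Sum>w\<in>t. u w *\<^sub>R w)"
      by (simp add: sum0 linear_0[OF T])
    also have "\<dots> = (\<Sum>w\<in>t. u w *\<^sub>R T i w)"
      by (simp add: linear_sum[OF T] linear_cmul[OF T])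
    also have "\<dots> = (\<Sum>w\<in>t. if w = v i then u (v i) *\<^sub>R T i (v i) else 0)"
    proof (rule sum.cong)
      fix w assume "w \<in> t"
      then obtain j where "w = v j" using t by blast
      then show "u w *\<^sub>R T i w = (if w = v i then u (v i) *\<^sub>R T i (v i) else 0)"
        using off[of i j] by (cases "i = j") auto
    qed simp
    also have "\<dots> = u (v i) *\<^sub>R T i (v i)"
      using t i by simp
    finally show False using diag i by simp
  qed
  moreover have "range v \<subseteq> span B" using v B by auto
  ultimately have "finite (range v)"
    using independent_span_bound B by blast
  moreover have "inj v"
    by (rule injI) (metis diag off)
  ultimately show False
    using finite_imageD infinite_UNIV_nat by blast
qed

section \<open>Cutting a function off outside an interval\<close>

lemma indicator_interval_measurable [measurable]:
  "indicat_real {a..b} \<in> borel_measurable lebesgue01"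
  by (intro measurable_restrict_space1 borel_measurable_indicator) simp

lift_definition cutoff :: "real \<Rightarrow> real \<Rightarrow> L0 \<Rightarrow> L0" is
  "\<lambda>a b f x. indicat_real {a..b} x * f x"
  by (auto simp: ae_eq_def elim: AE_mp)

lemma linear_cutoff: "linear (cutoff a b)"
proof (rule linearI)
  show "cutoff a b (f + g) = cutoff a b f + cutoff a b g" for f g
    by transfer (auto simp: ae_eq_def algebra_simps)
  show "cutoff a b (r *\<^sub>R f) = r *\<^sub>R cutoff a b f" for r f
    by transfer (auto simp: ae_eq_def algebra_simps)
qed

lemma dist_cutoff_le: "dist (cutoff a b f) (cutoff a b g) \<le> dist f g"
proof (transfer fixing: a b)
  fix f g assume "ae_eq f f" "ae_eq g g"
  then have m [measurable]: "f \<in> borel_measurable lebesgue01" "g \<in> borel_measurable lebesgue01"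
    by (auto simp: ae_eq_def)
  show "rho (\<lambda>x. indicat_real {a..b} x * f x) (\<lambda>x. indicat_real {a..b} x * g x) \<le> rho f g"
    unfolding rho_def
    by (intro integral_mono rho_integrable m) (measurable, auto simp: indicator_def)
qed

lemma continuous_on_cutoff: "continuous_on UNIV (cutoff a b)"
  unfolding continuous_on_iff using dist_cutoff_le le_less_trans by blast

lemma cutoff_unit_interval: "cutoff 0 1 f = f"
  by transfer (auto simp: ae_eq_def intro!: AE_I2)

section \<open>The typewriter intervals\<close>

text \<open>
  Writing \<open>n + 1 = 2\<^sup>k + j\<close> with \<open>j < 2\<^sup>k\<close>, the \<open>n\<close>-th interval is \<open>[j / 2\<^sup>k, (j + 1) / 2\<^sup>k]\<close>. The shift
  from \<open>n\<close> to \<open>n + 1\<close> makes the interval of index \<open>0\<close> the whole of \<open>[0,1]\<close>.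
\<close>

definition tw_left :: "nat \<Rightarrow> real" where
  "tw_left n = real (n + 1) / 2 ^ floor_log (n + 1) - 1"

definition tw_right :: "nat \<Rightarrow> real" where
  "tw_right n = real (n + 2) / 2 ^ floor_log (n + 1) - 1"

lemma tw_0: "tw_left 0 = 0" "tw_right 0 = 1"
  by (simp_all add: tw_left_def tw_right_def)

lemma tw_length_tendsto_0: "(\<lambda>n. tw_right n - tw_left n) \<longlonglongrightarrow> 0"
proof (rule tendsto_sandwich[of "\<lambda>_. 0"])
  have eq: "tw_right n - tw_left n = 1 / 2 ^ floor_log (n + 1)" for n
    by (simp add: tw_left_def tw_right_def field_simps)
  show "\<forall>\<^sub>F n in sequentially. 0 \<le> tw_right n - tw_left n"
    unfolding eq by simp
  have "1 / 2 ^ floor_log (n + 1) \<le> (2 :: real) * inverse (real (Suc n))" for n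
  proof -
    have "n + 1 < 2 * 2 ^ floor_log (n + 1)"
      using floor_log_exp2_gt by simp
    then have "real (n + 1) < 2 * 2 ^ floor_log (n + 1)"
      by (metis of_nat_less_numeral_power_cancel_iff power_Suc)
    then show ?thesis by (simp add: field_simps)
  qed
  then show "\<forall>\<^sub>F n in sequentially. tw_right n - tw_left n \<le> 2 * inverse (real (Suc n))"
    unfolding eq by simp
  show "(\<lambda>n. 2 * inverse (real (Suc n))) \<longlonglongrightarrow> 0"
    using tendsto_mult[OF tendsto_const[of 2] LIMSEQ_inverse_real_of_nat] by simp
qed simp

text \<open>
  For each \<open>k\<close> the \<open>2\<^sup>k\<close> intervals of length \<open>1 / 2\<^sup>k\<close> cover \<open>[0,1]\<close>, so a point is hit at least once in
  every generation.
\<close>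

lemma tw_covers_frequently:
  assumes "x \<in> {0..1}"
  shows "\<exists>\<^sub>F n in sequentially. x \<in> {tw_left n..tw_right n}"
  unfolding frequently_sequentially
proof
  fix N
  \<comment> \<open>The minimum matters only for \<open>x = 1\<close>, which belongs to the last interval of its generation.\<close>
  define j where "j = min (nat \<lfloor>x * 2 ^ N\<rfloor>) (2 ^ N - 1)"
  have j: "j < 2 ^ N" by (simp add: j_def min_def le_less_trans[of _ "2^N - 1"])
  have fl: "real (nat \<lfloor>x * 2 ^ N\<rfloor>) \<le> x * 2 ^ N" "x * 2 ^ N \<le> real (nat \<lfloor>x * 2 ^ N\<rfloor>) + 1"
    using assms by auto
  have x: "real j \<le> x * 2 ^ N" "x * 2 ^ N \<le> real j + 1"
  proof -
    show "real j \<le> x * 2 ^ N" using fl by (auto simp: j_def)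
    have "x * 2 ^ N \<le> 2 ^ N" using assms by simp
    then show "x * 2 ^ N \<le> real j + 1" using fl by (auto simp: j_def min_def of_nat_diff)
  qed
  define n where "n = 2 ^ N + j - 1"
  have n1: "n + 1 = 2 ^ N + j" by (simp add: n_def)
  have "floor_log (n + 1) = N"
    unfolding n1 using j by (intro floor_log_eqI) auto
  then have "x \<in> {tw_left n..tw_right n}"
    using x arg_cong[OF n1, of real] by (auto simp: tw_left_def tw_right_def field_simps)
  moreover have "N \<le> n"
    using n1 less_exp[of N] by linarith
  ultimately show "\<exists>n\<ge>N. x \<in> {tw_left n..tw_right n}" by blast
qed

section \<open>Cutoffs along the typewriter intervals\<close>

text \<open>
  Where the \<open>n\<close>-th term is nonzero is contained in the \<open>n\<close>-th interval, whatever the size of \<open>h\<close>.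
\<close>

lemma cutoff_tw_converges_in_measure:
  "converges_in_measure (\<lambda>n. cutoff (tw_left n) (tw_right n) h) 0"
proof (transfer, intro allI impI)
  fix h :: "real \<Rightarrow> real" and \<epsilon> :: real assume "ae_eq h h" "\<epsilon> > 0"
  show "(\<lambda>n. measure lebesgue01 {x \<in> {0..1}. \<epsilon> < \<bar>indicat_real {tw_left n..tw_right n} x * h x - 0\<bar>}) \<longlonglongrightarrow> 0"
  proof (rule tendsto_sandwich[OF _ _ tendsto_const tw_length_tendsto_0])
    have "measure lebesgue01 {x \<in> {0..1}. \<epsilon> < \<bar>indicat_real {tw_left n..tw_right n} x * h x - 0\<bar>}
        \<le> tw_right n - tw_left n" for n
    proof -
      have "measure lebesgue01 {x \<in> {0..1}. \<epsilon> < \<bar>indicat_real {tw_left n..tw_right n} x * h x - 0\<bar>}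
        \<le> measure lebesgue01 ({0..1} \<inter> {tw_left n..tw_right n})"
        using \<open>\<epsilon> > 0\<close>
        by (intro finite_measure.finite_measure_mono finite_measure_lebesgue01)
           (auto simp: indicator_def sets_restrict_space split: if_splits)
      also have "\<dots> = measure lebesgue ({0..1} \<inter> {tw_left n..tw_right n})"
        by (rule measure_restrict_space) auto
      also have "\<dots> \<le> measure lebesgue {tw_left n..tw_right n}"
        by (rule measure_mono_fmeasurable) auto
      also have "\<dots> = tw_right n - tw_left n"
        by (simp add: tw_left_def tw_right_def divide_right_mono)
      finally show ?thesis .
    qed
    then show "\<forall>\<^sub>F n in sequentially. measure lebesgue01 {x \<in> {0..1}. \<epsilon> < \<bar>indicat_real {tw_left n..tw_right n} x * h x - 0\<bar>}
        \<le> tw_right n - tw_left n" by simp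
  qed simp
qed

text \<open>
  If \<open>h x \<noteq> 0\<close>, convergence to \<open>0\<close> at \<open>x\<close> would keep the terms below \<open>\<bar>h x\<bar>\<close> eventually, but they are
  equal to \<open>h x\<close> whenever \<open>x\<close> is in the typewriter interval.
\<close>

lemma cutoff_tw_converges_ae_imp_0:
  assumes "converges_ae (\<lambda>n. cutoff (tw_left n) (tw_right n) h) 0"
  shows "h = 0"
  using assms
proof transfer
  fix h :: "real \<Rightarrow> real"
  assume h: "ae_eq h h"
    and lim: "AE x in lebesgue01. (\<lambda>n. indicat_real {tw_left n..tw_right n} x * h x) \<longlonglongrightarrow> 0"
  have "AE x in lebesgue01. x \<in> {0..1}"
    using AE_space[of lebesgue01] by simp
  with lim have "AE x in lebesgue01. h x = 0"
  proof eventually_elim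
    case (elim x)
    show ?case
    proof (rule ccontr)
      assume "h x \<noteq> 0"
      then have "\<forall>\<^sub>F n in sequentially. \<bar>indicat_real {tw_left n..tw_right n} x * h x\<bar> < \<bar>h x\<bar>"
        using tendstoD[OF elim(1), of "\<bar>h x\<bar>"] by simp
      then have "\<forall>\<^sub>F n in sequentially. x \<notin> {tw_left n..tw_right n}"
        by eventually_elim (auto simp: indicator_def split: if_splits)
      then show False
        using tw_covers_frequently[OF elim(2)] by (simp add: frequently_def)
    qed
  qed
  then show "ae_eq h (\<lambda>_. 0)"
    using h by (simp add: ae_eq_def)
qed

section \<open>Independent indicators and spaceability\<close>

lift_definition one_L0 :: L0 is "\<lambda>_. 1"
  by (simp add: ae_eq_def)

lemma cutoff_one_neq_0:
  assumes "0 \<le> a" "a < b" "b \<le> 1"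
  shows "cutoff a b one_L0 \<noteq> 0"
proof (transfer fixing: a b, rule notI)
  assume "ae_eq (\<lambda>x. indicat_real {a..b} x * 1) (\<lambda>_. 0)"
  then have "AE x in lebesgue. x \<in> {0..1} \<longrightarrow> x \<notin> {a..b}"
    by (simp add: ae_eq_def AE_restrict_space_iff indicator_def)
  then have "AE x in lebesgue. x \<notin> {a..b}"
    by eventually_elim (use assms in auto)
  then have "{a..b} \<in> null_sets lebesgue"
    by (subst (asm) AE_iff_null_sets[symmetric]) auto
  then have "measure lebesgue {a..b} = 0"
    by (simp add: measure_eq_0_null_sets)
  then show False
    using assms by simp
qed

lemma cutoff_cutoff_same: "cutoff a b (cutoff a b f) = cutoff a b f"
  by transfer (auto simp: ae_eq_def simp flip: mult.assoc indicator_inter_arith)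

text \<open>
  The two closed intervals have at most an endpoint in common, and a point is negligible.
\<close>

lemma cutoff_cutoff_eq_0:
  assumes "b \<le> c \<or> d \<le> a"
  shows "cutoff a b (cutoff c d f) = 0"
  using assms
proof (transfer fixing: a b c d)
  fix f assume "ae_eq f f" and le: "b \<le> c \<or> d \<le> a"
  then have [measurable]: "f \<in> borel_measurable lebesgue01"
    by (simp add: ae_eq_def)
  have ne: "AE x in lebesgue01. x \<noteq> y" for y :: real
    using AE_completion[OF AE_lborel_singleton[of y]]
    by (subst AE_restrict_space_iff) auto
  have "AE x in lebesgue01. indicat_real {a..b} x * (indicat_real {c..d} x * f x) = 0"
    using ne[of a] ne[of b] by eventually_elim (use le in \<open>auto simp: indicator_def\<close>)
  then show "ae_eq (\<lambda>x. indicat_real {a..b} x * (indicat_real {c..d} x * f x)) (\<lambda>_. 0)"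
    by (simp add: ae_eq_def)
qed

theorem theorem2p3:
  shows "spaceable {f :: nat \<Rightarrow> L0. converges_in_measure f 0 \<and> \<not> converges_ae f 0}"
  unfolding spaceable_def
proof (intro exI conjI)
  let ?C = "\<lambda>n. cutoff (tw_left n) (tw_right n)"
  define M where "M = {f. \<forall>n. f n = ?C n (f 0)}"
  show "subspace M"
  proof (rule subspaceI)
    show "0 \<in> M"
      by (simp add: M_def linear_0 linear_cutoff)
    show "f + g \<in> M" if "f \<in> M" "g \<in> M" for f g
      using that unfolding M_def mem_Collect_eq plus_fun_apply by (metis linear_add linear_cutoff)
    show "c *\<^sub>R f \<in> M" if "f \<in> M" for c f
      using that unfolding M_def mem_Collect_eq scaleR_fun_apply by (metis linear_cmul linear_cutoff)
  qed
  have "continuous_on UNIV (\<lambda>f. ?C n (f 0))" for n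
    by (rule continuous_on_compose2[OF continuous_on_cutoff continuous_on_product_coordinates]) simp
  then have "closed {f. f n = ?C n (f 0)}" for n
    by (intro closed_Collect_eq continuous_on_product_coordinates)
  then show "closed M"
    unfolding M_def by (rule closed_Collect_all)
  \<comment> \<open>The intervals \<open>[1 / (k + 2), 1 / (k + 1)]\<close> do not overlap; their indicators yield the
    biorthogonal system.\<close>
  define l where "l k = 1 / real (k + 2)" for k :: nat
  define r where "r k = 1 / real (k + 1)" for k :: nat
  have lr: "0 \<le> l k" "l k < r k" "r k \<le> 1" for k
    by (simp_all add: l_def r_def field_simps)
  have rl: "r j \<le> l i" if "i < j" for i j
    using that by (simp add: l_def r_def field_simps)
  show "infinite_dimensional M"
  proof (rule infinite_dimensional_if_biorthogonal)
    show "(\<lambda>n. ?C n (cutoff (l k) (r k) one_L0)) \<in> M" for k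
      by (simp add: M_def tw_0 cutoff_unit_interval)
    show "linear (\<lambda>f. cutoff (l k) (r k) (f 0))" for k
      by (rule linearI) (simp_all add: linear_add linear_cmul linear_cutoff)
    show "cutoff (l k) (r k) (?C 0 (cutoff (l k) (r k) one_L0)) \<noteq> 0" for k
      using cutoff_one_neq_0 lr by (simp add: tw_0 cutoff_unit_interval cutoff_cutoff_same)
    show "cutoff (l i) (r i) (?C 0 (cutoff (l j) (r j) one_L0)) = 0" if "i \<noteq> j" for i j
      using rl[of i j] rl[of j i] that cutoff_cutoff_eq_0
      by (auto simp: tw_0 cutoff_unit_interval neq_iff)
  qed
  show "M - {0} \<subseteq> {f. converges_in_measure f 0 \<and> \<not> converges_ae f 0}"
  proof clarify
    fix f assume "f \<in> M" "f \<noteq> 0"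
    then have f: "f = (\<lambda>n. ?C n (f 0))"
      unfolding M_def by blast
    have "f 0 \<noteq> 0"
      using \<open>f \<noteq> 0\<close> f by (metis (no_types) ext linear_0 linear_cutoff zero_fun_apply)
    with f show "converges_in_measure f 0 \<and> \<not> converges_ae f 0"
      using cutoff_tw_converges_in_measure cutoff_tw_converges_ae_imp_0 by metis
  qed
qed

end
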